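(* Let $K$ and $L$ be locally compact Hausdorff spaces and let $X$ be a real Banach space containing no isomorphic copy of $c_0$. If there exists an isomorphic embedding of $C_0(K)$ into $C_0(L,X)$ and $L$ is scattered, then $K$ is scattered.
   Context: For a locally compact Hausdorff space $K$ and a real Banach space $X$, $C_0(K,X)$ denotes the Banach space of all continuous functions $f:K\to X$ vanishing at infinity, with the norm $\|f\|=\sup_{x\in K}\|f(x)\|$; $C_0(K)=C_0(K,\mathbb{R})$, and $c_0=C_0(\mathbb{N})$. A linear operator $T:X\to Y$ between Banach spaces is an isomorphic embedding if there are $A,B>0$ with $A\|u\|\le\|Tu\|\le B\|u\|$ for all $u\in X$. A topological space is scattered if every nonempty subset has an isolated point (in the relative topology). *)

theory Defs
  imports "HOL-Analysis.Analysis"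
begin

definition C0 :: "('a::topological_space \<Rightarrow> 'b::real_normed_vector) set" where
  "C0 = {f. continuous_on UNIV f \<and> (\<forall>e>0. compact {x. e \<le> norm (f x)})}"

definition supnorm :: "('a \<Rightarrow> 'b::real_normed_vector) \<Rightarrow> real" where
  "supnorm f = (SUP x. norm (f x))"

definition iso_embedding_on ::
  "('a \<Rightarrow> 'b::real_vector) set \<Rightarrow> (('a \<Rightarrow> 'b) \<Rightarrow> real) \<Rightarrow> ('v::real_vector \<Rightarrow> real)
     \<Rightarrow> (('a \<Rightarrow> 'b) \<Rightarrow> 'v) \<Rightarrow> bool" where
  "iso_embedding_on A nA nB T \<longleftrightarrow>
     (\<forall>f\<in>A. \<forall>g\<in>A. T (\<lambda>x. f x + g x) = T f + T g) \<and>
     (\<forall>c. \<forall>f\<in>A. T (\<lambda>x. c *\<^sub>R f x) = c *\<^sub>R T f) \<and>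
     (\<exists>a b. a > 0 \<and> b > 0 \<and> (\<forall>u\<in>A. a * nA u \<le> nB (T u) \<and> nB (T u) \<le> b * nA u))"

definition iso_embedding_fun_on ::
  "('a \<Rightarrow> 'b::real_vector) set \<Rightarrow> (('a \<Rightarrow> 'b) \<Rightarrow> real) \<Rightarrow> (('c \<Rightarrow> 'd::real_vector) \<Rightarrow> real)
     \<Rightarrow> (('a \<Rightarrow> 'b) \<Rightarrow> ('c \<Rightarrow> 'd)) \<Rightarrow> bool" where
  "iso_embedding_fun_on A nA nB T \<longleftrightarrow>
     (\<forall>f\<in>A. \<forall>g\<in>A. T (\<lambda>x. f x + g x) = (\<lambda>y. T f y + T g y)) \<and>
     (\<forall>c. \<forall>f\<in>A. T (\<lambda>x. c *\<^sub>R f x) = (\<lambda>y. c *\<^sub>R T f y)) \<and>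
     (\<exists>a b. a > 0 \<and> b > 0 \<and> (\<forall>u\<in>A. a * nA u \<le> nB (T u) \<and> nB (T u) \<le> b * nA u))"

definition scattered_space :: "'a::topological_space itself \<Rightarrow> bool" where
  "scattered_space _ \<longleftrightarrow>
     (\<forall>S::'a set. S \<noteq> {} \<longrightarrow> (\<exists>x\<in>S. \<exists>U. open U \<and> U \<inter> S = {x}))"

end

theory Submission
  imports Defs
begin

text \<open>Let \<open>P \<subseteq> K\<close> be nonempty without isolated points, and call an open \<open>U \<subseteq> L\<close> good if for every
  compact \<open>C \<subseteq> U\<close>, every open \<open>V\<close> meeting \<open>P\<close> contains the support of a function of norm 1, equal to 1
  on a smaller open set meeting \<open>P\<close>, whose image under \<open>T\<close> is uniformly small on \<open>C\<close>. Unions of chains of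
  good sets are good by compactness. Adding a point \<open>y\<close> to a good set keeps it good: since \<open>X\<close> contains
  no \<open>c\<^sub>0\<close>, after shrinking \<open>V\<close> all images are small at \<open>y\<close>, so each image is large on \<open>C\<close> only on a compact
  subset of \<open>U\<close>; one can then choose nested functions \<open>f\<^sub>i\<close> whose images are large on disjoint sets,
  and the average of \<open>f\<^sub>1, \<dots>, f\<^sub>n\<close> has norm 1 and a small image. As \<open>L\<close> is scattered, a maximal good set
  is all of \<open>L\<close>. Images vanish at infinity, so one more averaging gives a function of norm 1 whose image
  is small everywhere on \<open>L\<close>, which contradicts the lower bound of \<open>T\<close>.\<close>

section \<open>Series in a Banach space that span copies of c_0\<close>

lemma abs_sum_disjoint_le_one:
  fixes u :: "'i \<Rightarrow> real"
  assumes "finite F" and "\<And>i. i \<in> F \<Longrightarrow> \<bar>u i\<bar> \<le> 1"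
    and "\<And>i j. i \<in> F \<Longrightarrow> j \<in> F \<Longrightarrow> i \<noteq> j \<Longrightarrow> u i = 0 \<or> u j = 0"
  shows "\<bar>sum u F\<bar> \<le> 1"
proof (cases "\<exists>i\<in>F. u i \<noteq> 0")
  case True
  then obtain i where i: "i \<in> F" "u i \<noteq> 0" by blast
  have "sum u F = u i + sum u (F - {i})"
    using assms(1) i(1) by (rule sum.remove)
  moreover have "sum u (F - {i}) = 0"
    using assms(3) i by (intro sum.neutral) blast
  ultimately show ?thesis using assms(2) i by simp
next
  case False
  then have "sum u F = 0" by (intro sum.neutral) blast
  then show ?thesis by simp
qed

text \<open>Supplies the boundedness without which the real \<open>SUP\<close> in
  \<open>supnorm\<close> carries no information.\<close>

lemma C0_bounded:
  fixes f :: "'a::topological_space \<Rightarrow> 'b::real_normed_vector"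
  assumes "f \<in> C0"
  shows "\<exists>s. \<forall>x. norm (f x) \<le> s"
proof -
  define D where "D = {x. 1 \<le> norm (f x)}"
  have "continuous_on UNIV f" "compact D" using assms by (auto simp: C0_def D_def)
  then have "bounded (f ` D)"
    by (metis compact_continuous_image compact_imp_bounded continuous_on_subset top_greatest)
  then obtain s where "\<And>x. x \<in> D \<Longrightarrow> norm (f x) \<le> s" by (auto simp: bounded_iff)
  then have "norm (f x) \<le> max 1 s" for x by (cases "x \<in> D") (force simp: D_def)+
  then show ?thesis by blast
qed

text \<open>Compact subsets of the discrete space \<open>nat\<close> are finite.\<close>

lemma C0_nat_tendsto:
  fixes c :: "nat \<Rightarrow> real"
  assumes "c \<in> C0"
  shows "c \<longlonglongrightarrow> 0"
proof (rule LIMSEQ_I)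
  fix e :: real assume "e > 0"
  then have "compact {x. e \<le> norm (c x)}" using assms unfolding C0_def by blast
  then obtain D where "D \<subseteq> UNIV" "finite D" "{x. e \<le> norm (c x)} \<subseteq> (\<Union>n\<in>D. {n})"
    by (rule compactE_image[where C = UNIV and f = "\<lambda>n. {n}"]) (auto simp: open_discrete)
  then have "finite {x. e \<le> norm (c x)}" by (meson finite_UN finite.intros finite_subset)
  then show "\<exists>no. \<forall>n\<ge>no. norm (c n - 0) < e"
    by (metis (mono_tags, lifting) diff_zero finite_nat_set_iff_bounded linorder_not_le mem_Collect_eq)
qed

lemma norm_le_supnorm:
  assumes "\<And>x. norm (f x) \<le> s"
  shows "norm (f x) \<le> supnorm f"
  unfolding supnorm_def using assms by (intro cSUP_upper bdd_aboveI2) auto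

lemma supnorm_le:
  assumes "\<And>x. norm (f x) \<le> s"
  shows "supnorm f \<le> s"
  unfolding supnorm_def using assms by (intro cSUP_least) auto

text \<open>Flipping the signs of all coefficients of \<open>\<Sum> c\<^sub>j b\<^sub>j\<close> but the \<open>k\<close>-th and averaging gives the lower
  bound \<open>2 l \<bar>c\<^sub>k\<bar> - u \<parallel>c\<parallel>\<close>, so no norming functionals are needed.\<close>

lemma c0_embedding_of_series:
  fixes b :: "nat \<Rightarrow> 'x::banach"
  assumes upper: "\<And>c p. (\<And>j. \<bar>c j\<bar> \<le> 1) \<Longrightarrow> norm (\<Sum>j<p. c j *\<^sub>R b j) \<le> u"
    and lower: "\<And>j. l \<le> norm (b j)" and ul: "u < 2 * l"
  shows "\<exists>S :: (nat \<Rightarrow> real) \<Rightarrow> 'x. iso_embedding_on C0 supnorm norm S"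
proof -
  have u0: "0 \<le> u" using upper[of "\<lambda>_. 0" 0] by simp
  then have l0: "l > 0" using ul by linarith
  have up: "norm (\<Sum>j<p. c j *\<^sub>R b j) \<le> u * s" if "\<And>j. \<bar>c j\<bar> \<le> s" for c :: "nat \<Rightarrow> real" and s p
  proof (cases "s = 0")
    case True
    then show ?thesis using that by simp
  next
    case False
    then have s: "s > 0" using that[of 0] by linarith
    have eq: "(\<Sum>j<p. c j *\<^sub>R b j) = s *\<^sub>R (\<Sum>j<p. (c j / s) *\<^sub>R b j)"
      using s by (simp add: scaleR_sum_right)
    have "norm (\<Sum>j<p. (c j / s) *\<^sub>R b j) \<le> u"
      using s that by (intro upper) (simp add: abs_divide)
    then show ?thesis unfolding eq using s by (simp add: mult.commute)
  qed
  have summ: "summable (\<lambda>j. c j *\<^sub>R b j)" if c: "c \<in> C0" for c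
    unfolding summable_Cauchy
  proof (intro allI impI)
    fix e :: real assume e: "e > 0"
    \<comment> \<open>Dividing by \<open>u + 1\<close> avoids a zero denominator and makes
      \<open>u * d < e\<close> strict.\<close>
    define d where "d = e / (u + 1)"
    have d: "d > 0" "u * d < e" using e u0 by (auto simp: d_def field_simps)
    obtain N where N: "\<And>n. n \<ge> N \<Longrightarrow> \<bar>c n\<bar> < d"
      using LIMSEQ_D[OF C0_nat_tendsto[OF c] d(1)] by auto
    show "\<exists>N. \<forall>m\<ge>N. \<forall>n. norm (\<Sum>j\<in>{m..<n}. c j *\<^sub>R b j) < e"
    proof (intro exI allI impI)
      fix m n assume m: "m \<ge> N"
      \<comment> \<open>Zeroing the coefficients below \<open>m\<close> turns the tail into an
        initial sum, to which \<open>up\<close> applies.\<close>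
      define c' where "c' j = (if j < m then 0 else c j)" for j
      have "(\<Sum>j\<in>{m..<n}. c j *\<^sub>R b j) = (\<Sum>j<n. c' j *\<^sub>R b j)"
        by (rule sum.mono_neutral_cong_left) (auto simp: c'_def)
      also have "norm \<dots> \<le> u * d"
        using N m d by (intro up) (auto simp: c'_def intro: less_imp_le)
      finally show "norm (\<Sum>j\<in>{m..<n}. c j *\<^sub>R b j) < e" using d by linarith
    qed
  qed
  define S where "S c = (\<Sum>j. c j *\<^sub>R b j)" for c
  have lim: "(\<lambda>p. norm (\<Sum>j<p. c j *\<^sub>R b j)) \<longlonglongrightarrow> norm (S c)" if "c \<in> C0" for c
    unfolding S_def using summable_LIMSEQ[OF summ[OF that]] by (rule tendsto_norm)
  have bd: "\<bar>c j\<bar> \<le> supnorm c" if c: "c \<in> C0" for c :: "nat \<Rightarrow> real" and j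
  proof -
    obtain s where "\<And>x. norm (c x) \<le> s" using C0_bounded[OF c] by blast
    from norm_le_supnorm[OF this] show ?thesis by simp
  qed
  have "iso_embedding_on C0 supnorm norm S"
    unfolding iso_embedding_on_def
  proof (intro conjI ballI allI)
    fix f g :: "nat \<Rightarrow> real" assume "f \<in> C0" "g \<in> C0"
    then show "S (\<lambda>x. f x + g x) = S f + S g"
      unfolding S_def by (simp add: scaleR_add_left suminf_add summ)
  next
    fix c and f :: "nat \<Rightarrow> real" assume "f \<in> C0"
    then show "S (\<lambda>x. c *\<^sub>R f x) = c *\<^sub>R S f"
      unfolding S_def using suminf_scaleR_right[OF summ, of f c] by simp
  next
    have "(2 * l - u) * supnorm c \<le> norm (S c)" if c: "c \<in> C0" for c
    proof -
      have "\<bar>c k\<bar> \<le> (norm (S c) + u * supnorm c) / (2 * l)" for k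
      proof -
        define c' where "c' j = (if j = k then c j else - c j)" for j
        have "2 * l * \<bar>c k\<bar> - u * supnorm c \<le> norm (\<Sum>j<p. c j *\<^sub>R b j)" if "p \<ge> Suc k" for p
        proof -
          have "(\<Sum>j<p. c j *\<^sub>R b j) + (\<Sum>j<p. c' j *\<^sub>R b j)
             = (\<Sum>j<p. if j = k then (2 * c k) *\<^sub>R b k else 0)"
            unfolding sum.distrib[symmetric]
            by (rule sum.cong) (auto simp: c'_def scaleR_left_distrib[symmetric])
          also have "\<dots> = (2 * c k) *\<^sub>R b k" using that by (simp add: sum.delta)
          finally have "2 * \<bar>c k\<bar> * norm (b k)
             = norm ((\<Sum>j<p. c j *\<^sub>R b j) + (\<Sum>j<p. c' j *\<^sub>R b j))"
            by (simp add: abs_mult)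
          also have "\<dots> \<le> norm (\<Sum>j<p. c j *\<^sub>R b j) + u * supnorm c"
            using up[of c' "supnorm c" p] bd[OF c]
            by (intro order_trans[OF norm_triangle_ineq]) (auto simp: c'_def)
          finally show ?thesis
            using mult_left_mono[OF lower[of k], of "2 * \<bar>c k\<bar>"] by (simp add: mult_ac)
        qed
        then have "2 * l * \<bar>c k\<bar> - u * supnorm c \<le> norm (S c)"
          using LIMSEQ_le_const[OF lim[OF c]] by blast
        then show ?thesis using l0 by (simp add: field_simps)
      qed
      \<comment> \<open>Supremum over \<open>k\<close>. The term \<open>u * supnorm c\<close> is
        then absorbed on the left, leaving the positive factor \<open>2 * l - u\<close>.\<close>
      then have "supnorm c \<le> (norm (S c) + u * supnorm c) / (2 * l)"
        by (intro supnorm_le) simp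
      then show ?thesis using l0 by (simp add: field_simps)
    qed
    moreover have "norm (S c) \<le> (u + 1) * supnorm c" if c: "c \<in> C0" for c
    proof -
      have "norm (S c) \<le> u * supnorm c"
        using LIMSEQ_le_const2[OF lim[OF c]] up[of c "supnorm c"] bd[OF c] by blast
      moreover have "0 \<le> supnorm c" using bd[OF c, of 0] by linarith
      ultimately show ?thesis by (simp add: algebra_simps)
    qed
    ultimately show "\<exists>\<alpha> \<beta>. \<alpha> > 0 \<and> \<beta> > 0 \<and> (\<forall>c\<in>C0. \<alpha> * supnorm c \<le> norm (S c) \<and> norm (S c) \<le> \<beta> * supnorm c)"
      using u0 ul by (intro exI[of _ "2 * l - u"] exI[of _ "u + 1"]) auto
  qed
  then show ?thesis by blast
qed

text \<open>James' distortion argument: \<open>\<kappa> n\<close>, the supremum of the norms of the combinations of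
  \<open>x\<^sub>n, x\<^sub>n\<^sub>+\<^sub>1, \<dots>\<close> with coefficients in \<open>[-1, 1]\<close>, decreases to some \<open>k > 0\<close>, so beyond some \<open>n0\<close>
  there are successive blocks \<open>b\<^sub>j\<close> of norm at least \<open>7k/8\<close> whose combinations have norm at most
  \<open>9k/8\<close>.\<close>

lemma c0_embedding_of_bounded_series:
  fixes x :: "nat \<Rightarrow> 'x::banach"
  assumes bounded: "\<And>c p. (\<And>j. \<bar>c j\<bar> \<le> 1) \<Longrightarrow> norm (\<Sum>j<p. c j *\<^sub>R x j) \<le> B"
    and lower: "\<And>j. \<epsilon> \<le> norm (x j)" and "\<epsilon> > 0"
  shows "\<exists>S :: (nat \<Rightarrow> real) \<Rightarrow> 'x. iso_embedding_on C0 supnorm norm S"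
proof -
  define A where "A n = {norm (\<Sum>i<m. a i *\<^sub>R x i) | m a. (\<forall>i. \<bar>a i\<bar> \<le> 1) \<and> (\<forall>i<n. a i = 0)}" for n :: nat
  define \<kappa> where "\<kappa> n = Sup (A n)" for n
  define k where "k = Inf (range \<kappa>)"
  have bdd: "bdd_above (A n)" for n
    using bounded by (intro bdd_aboveI[of _ B]) (auto simp: A_def)
  have ge: "\<epsilon> \<le> \<kappa> n" for n
  proof -
    \<comment> \<open>The coefficients form the \<open>n\<close>-th unit vector. The resulting bound
      keeps the infimum \<open>k\<close> positive.\<close>
    have "norm (\<Sum>i<Suc n. (if i = n then 1 else 0) *\<^sub>R x i) \<in> A n"
      unfolding A_def by (intro CollectI exI conjI) (rule refl, auto)
    then have "norm (x n) \<in> A n" by (simp add: if_distribR)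
    then have "norm (x n) \<le> \<kappa> n" unfolding \<kappa>_def using bdd by (intro cSup_upper)
    then show ?thesis using lower[of n] by linarith
  qed
  have bb: "bdd_below (range \<kappa>)" using ge by (intro bdd_belowI2)
  have k0: "k > 0" using ge \<open>\<epsilon> > 0\<close> cINF_greatest[of UNIV \<epsilon> \<kappa>] unfolding k_def by auto
  have k_le: "k \<le> \<kappa> n" for n unfolding k_def using bb by (intro cINF_lower) auto
  \<comment> \<open>A factor above 1 here and one below 1 for the blocks suffice if the first is
    less than twice the second: 9/8 < 7/4.\<close>
  have "\<exists>n0. \<kappa> n0 < 9/8 * k"
    using cInf_lessD[of "range \<kappa>" "9/8 * k"] k0 unfolding k_def by auto
  then obtain n0 where n0: "\<kappa> n0 < 9/8 * k" by blast
  have "\<exists>m a. n \<le> m \<and> (\<forall>i. \<bar>a i\<bar> \<le> 1) \<and> (\<forall>i. a i \<noteq> 0 \<longrightarrow> n \<le> i \<and> i < m)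
      \<and> 7/8 * k \<le> norm (\<Sum>i<m. a i *\<^sub>R x i)" for n
  proof -
    have "7/8 * k < Sup (A n)" using k0 k_le[of n] by (simp add: \<kappa>_def)
    moreover have "A n \<noteq> {}" unfolding A_def by (auto intro!: exI[of _ "\<lambda>_. 0"])
    ultimately obtain y where "y \<in> A n" "7/8 * k < y" using less_cSupD by blast
    then obtain m a where a: "\<And>i. \<bar>a i\<bar> \<le> 1" "\<And>i. i < n \<Longrightarrow> a i = 0"
        "7/8 * k < norm (\<Sum>i<m. a i *\<^sub>R x i)"
      unfolding A_def by blast
    have "n \<le> m"
    proof (rule ccontr)
      assume "\<not> n \<le> m"
      then have "(\<Sum>i<m. a i *\<^sub>R x i) = 0" using a(2) by (intro sum.neutral) auto
      then show False using a(3) k0 by simp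
    qed
    \<comment> \<open>Cutting \<open>a\<close> off at \<open>m\<close> leaves the sum unchanged and
      confines the block to indices from \<open>n\<close> to \<open>m - 1\<close>.\<close>
    moreover have "(\<Sum>i<m. (if i < m then a i else 0) *\<^sub>R x i) = (\<Sum>i<m. a i *\<^sub>R x i)"
      by (rule sum.cong) auto
    ultimately show ?thesis using a
      by (intro exI[of _ m] exI[of _ "\<lambda>i. if i < m then a i else 0"]) (auto, meson not_le)
  qed
  then obtain q a where qa: "\<And>n. n \<le> q n" "\<And>n i. \<bar>a n i\<bar> \<le> 1"
      "\<And>n i. a n i \<noteq> 0 \<Longrightarrow> n \<le> i \<and> i < q n"
      "\<And>n. 7/8 * k \<le> norm (\<Sum>i<q n. a n i *\<^sub>R x i)"
    by metis
  \<comment> \<open>Block \<open>j\<close> occupies indices from \<open>N j\<close> up to, but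
    excluding, \<open>N (Suc j)\<close>; so the blocks are disjoint and start no earlier than
    \<open>n0\<close>.\<close>
  define N where "N j = (q ^^ j) n0" for j
  have NS: "N (Suc j) = q (N j)" for j by (simp add: N_def)
  have Nmono: "N i \<le> N j" if "i \<le> j" for i j
    using that by (rule lift_Suc_mono_le[rotated]) (simp add: NS qa(1))
  define b where "b j = (\<Sum>i<q (N j). a (N j) i *\<^sub>R x i)" for j
  show ?thesis
  proof (rule c0_embedding_of_series[of b "9/8 * k" "7/8 * k"])
    show "7/8 * k \<le> norm (b j)" for j unfolding b_def by (rule qa(4))
    show "9/8 * k < 2 * (7/8 * k)" using k0 by simp
  next
    fix c :: "nat \<Rightarrow> real" and p assume c: "\<And>j. \<bar>c j\<bar> \<le> 1"
    \<comment> \<open>These are the coefficients of the block combination with respect to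
      \<open>x\<close>. By disjointness they stay in [-1, 1], and they vanish below
      \<open>n0\<close>, so \<open>\<kappa> n0\<close> bounds the norm.\<close>
    define d where "d i = (\<Sum>j<p. c j * a (N j) i)" for i
    have "\<bar>d i\<bar> \<le> 1" for i
      unfolding d_def
    proof (rule abs_sum_disjoint_le_one)
      show "\<bar>c j * a (N j) i\<bar> \<le> 1" for j
        using c[of j] qa(2)[of "N j" i] by (simp add: abs_mult mult_le_one)
      have aux: "a (N j) i = 0 \<or> a (N j') i = 0" if "j < j'" for j j'
        using qa(3)[of "N j" i] qa(3)[of "N j'" i] Nmono[of "Suc j" j'] that
        by (fastforce simp: NS)
      show "c j * a (N j) i = 0 \<or> c j' * a (N j') i = 0" if "j \<noteq> j'" for j j'
        using aux[of j j'] aux[of j' j] that by (auto simp: neq_iff)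
    qed simp
    moreover have "d i = 0" if "i < n0" for i
      unfolding d_def
    proof (rule sum.neutral, rule ballI)
      fix j
      have "n0 \<le> N j" using Nmono[of 0 j] by (simp add: N_def)
      then show "c j * a (N j) i = 0" using qa(3)[of "N j" i] that by auto
    qed
    ultimately have "norm (\<Sum>i<N p. d i *\<^sub>R x i) \<in> A n0" unfolding A_def by blast
    then have "norm (\<Sum>i<N p. d i *\<^sub>R x i) \<le> \<kappa> n0" unfolding \<kappa>_def using bdd by (rule cSup_upper)
    moreover have "(\<Sum>i<N p. d i *\<^sub>R x i) = (\<Sum>j<p. c j *\<^sub>R b j)"
    proof -
      have bj: "b j = (\<Sum>i<N p. a (N j) i *\<^sub>R x i)" if "j < p" for j
        unfolding b_def
      proof (rule sum.mono_neutral_left)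
        show "{..<q (N j)} \<subseteq> {..<N p}" using Nmono[of "Suc j" p] that by (auto simp: NS)
        show "\<forall>i\<in>{..<N p} - {..<q (N j)}. a (N j) i *\<^sub>R x i = 0"
          using qa(3)[of "N j"] by (metis DiffE lessThan_iff scaleR_zero_left)
      qed simp
      have "(\<Sum>i<N p. d i *\<^sub>R x i) = (\<Sum>i<N p. \<Sum>j<p. (c j * a (N j) i) *\<^sub>R x i)"
        unfolding d_def by (simp add: scaleR_sum_left)
      also have "\<dots> = (\<Sum>j<p. \<Sum>i<N p. (c j * a (N j) i) *\<^sub>R x i)" by (rule sum.swap)
      also have "\<dots> = (\<Sum>j<p. c j *\<^sub>R b j)"
        by (rule sum.cong) (auto simp: bj scaleR_sum_right)
      finally show ?thesis .
    qed
    ultimately show "norm (\<Sum>j<p. c j *\<^sub>R b j) \<le> 9/8 * k" using n0 by simp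
  qed
qed

section \<open>The space C_0 and its bump functions\<close>

lemma C0_zero: "(\<lambda>_. 0) \<in> C0"
  by (auto simp: C0_def)

lemma closed_norm_ge:
  fixes f :: "'a::topological_space \<Rightarrow> 'b::real_normed_vector"
  assumes "continuous_on UNIV f"
  shows "closed {x. e \<le> norm (f x)}"
  using assms by (intro closed_Collect_le continuous_intros)

lemma C0_add:
  fixes f g :: "'a::topological_space \<Rightarrow> 'b::real_normed_vector"
  assumes "f \<in> C0" "g \<in> C0"
  shows "(\<lambda>x. f x + g x) \<in> C0"
proof -
  have cont: "continuous_on UNIV (\<lambda>x. f x + g x)"
    using assms by (auto simp: C0_def intro: continuous_intros)
  have "compact {x. e \<le> norm (f x + g x)}" if "e > 0" for e
  proof -
    define D where "D = {x. e/2 \<le> norm (f x)} \<union> {x. e/2 \<le> norm (g x)}"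
    have "compact D" using assms that half_gt_zero unfolding D_def C0_def by blast
    moreover have "{x. e \<le> norm (f x + g x)} \<subseteq> D"
    proof
      fix x assume "x \<in> {x. e \<le> norm (f x + g x)}"
      then have "e \<le> norm (f x) + norm (g x)" using norm_triangle_ineq[of "f x" "g x"] by simp
      then show "x \<in> D" by (auto simp: D_def)
    qed
    ultimately show ?thesis
      using compact_Int_closed[OF _ closed_norm_ge[OF cont]] by (metis inf.absorb_iff2)
  qed
  then show ?thesis using cont by (simp add: C0_def)
qed

lemma C0_scaleR:
  fixes f :: "'a::topological_space \<Rightarrow> 'b::real_normed_vector"
  assumes "f \<in> C0"
  shows "(\<lambda>x. c *\<^sub>R f x) \<in> C0"
proof (cases "c = 0")
  case True
  then show ?thesis using C0_zero by simp
next
  case False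
  have "continuous_on UNIV (\<lambda>x. c *\<^sub>R f x)"
    using assms by (auto simp: C0_def intro: continuous_intros)
  moreover have "compact {x. e \<le> norm (c *\<^sub>R f x)}" if "e > 0" for e
  proof -
    have "{x. e \<le> norm (c *\<^sub>R f x)} = {x. e / \<bar>c\<bar> \<le> norm (f x)}"
      using False by (auto simp: field_simps)
    then show ?thesis using assms that False by (simp add: C0_def)
  qed
  ultimately show ?thesis by (simp add: C0_def)
qed

text \<open>Locally compact Hausdorff spaces are completely regular. The plateau \<open>W\<close> on
  which \<open>f\<close> is 1 leaves room for nesting further bumps.\<close>

lemma C0_bump:
  fixes x :: "'k::t2_space"
  assumes "locally_compact_space (euclidean :: 'k topology)" and "open V" "x \<in> V"
  obtains f :: "'k \<Rightarrow> real" and W where "f \<in> C0" "\<And>z. \<bar>f z\<bar> \<le> 1" "\<And>z. z \<notin> V \<Longrightarrow> f z = 0"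
    "open W" "x \<in> W" "W \<subseteq> V" "\<And>z. z \<in> W \<Longrightarrow> f z = 1"
proof -
  obtain U D where U: "open U" "compact D" "x \<in> U" "U \<subseteq> D"
    using assms(1) unfolding locally_compact_space_def by simp metis
  have "Hausdorff_space (euclidean :: 'k topology)"
    unfolding Hausdorff_space_def using hausdorff by (fastforce simp: disjnt_def)
  then have cr: "completely_regular_space (euclidean :: 'k topology)"
    using assms(1) locally_compact_regular_imp_completely_regular_space by blast
  have "openin euclidean (U \<inter> V)" "x \<in> U \<inter> V" using U assms by auto
  with cr[unfolded completely_regular_space_alt'] obtain g :: "'k \<Rightarrow> real" where
    g': "continuous_map euclidean euclidean g" "g x = 0" "g ` (topspace euclidean - U \<inter> V) \<subseteq> {1}"
    by blast
  have g: "continuous_on UNIV g" "g x = 0" "\<And>z. z \<notin> U \<inter> V \<Longrightarrow> g z = 1"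
    using g' by (auto simp: image_subset_iff)
  \<comment> \<open>Doubling before clipping creates the plateau where \<open>g z < 1/2\<close>.
    Clipping also bounds \<open>f\<close>, as nothing is known about the range of
    \<open>g\<close>.\<close>
  define f where "f z = max 0 (min 1 (2 * (1 - g z)))" for z
  define W where "W = {z. g z < 1/2}"
  have cont: "continuous_on UNIV f" unfolding f_def by (intro continuous_intros g)
  have f0: "f z = 0" if "z \<notin> U \<inter> V" for z using g(3)[OF that] by (simp add: f_def)
  have "compact {z. e \<le> norm (f z)}" if "e > 0" for e
  proof -
    have "{z. e \<le> norm (f z)} \<subseteq> D" using f0 U that by fastforce
    then show ?thesis
      using compact_Int_closed[OF U(2) closed_norm_ge[OF cont]] by (metis inf.absorb_iff2)
  qed
  then have "f \<in> C0" using cont by (simp add: C0_def)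
  moreover have "open W" unfolding W_def by (intro open_Collect_less continuous_intros g)
  moreover have "W \<subseteq> V"
  proof
    fix z assume "z \<in> W" then show "z \<in> V" using g(3)[of z] by (force simp: W_def)
  qed
  moreover have "f z = 1" if "z \<in> W" for z using that by (simp add: f_def W_def)
  moreover have "x \<in> W" by (simp add: W_def g)
  moreover have "\<bar>f z\<bar> \<le> 1" for z by (simp add: f_def)
  ultimately show ?thesis using that f0 by blast
qed

section \<open>Images of bumps around a set without isolated points\<close>

locale perfect_set_embedding =
  fixes T :: "('k::t2_space \<Rightarrow> real) \<Rightarrow> ('l::t2_space \<Rightarrow> 'x::banach)"
    and P :: "'k set" and \<alpha> \<beta> :: real
  assumes loc_compact: "locally_compact_space (euclidean :: 'k topology)"
    and no_c0: "\<not> (\<exists>S :: (nat \<Rightarrow> real) \<Rightarrow> 'x. iso_embedding_on C0 supnorm norm S)"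
    and T_C0: "\<And>f. f \<in> C0 \<Longrightarrow> T f \<in> C0"
    and T_add: "\<And>f g. f \<in> C0 \<Longrightarrow> g \<in> C0 \<Longrightarrow> T (\<lambda>x. f x + g x) = (\<lambda>y. T f y + T g y)"
    and T_scaleR: "\<And>c f. f \<in> C0 \<Longrightarrow> T (\<lambda>x. c *\<^sub>R f x) = (\<lambda>y. c *\<^sub>R T f y)"
    and \<alpha>: "0 < \<alpha>" "\<And>f. f \<in> C0 \<Longrightarrow> \<alpha> * supnorm f \<le> supnorm (T f)"
    and \<beta>: "0 < \<beta>" "\<And>f. f \<in> C0 \<Longrightarrow> supnorm (T f) \<le> \<beta> * supnorm f"
    and P_dense_in_itself: "\<And>x U. open U \<Longrightarrow> U \<inter> P \<noteq> {x}"
begin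

text \<open>Such \<open>V\<close> stand for the nonempty relatively open subsets of
  \<open>P\<close>.\<close>

definition meets :: "'k set \<Rightarrow> bool" where
  "meets V \<longleftrightarrow> open V \<and> V \<inter> P \<noteq> {}"

definition unit_on :: "'k set \<Rightarrow> ('k \<Rightarrow> real) \<Rightarrow> bool" where
  "unit_on V g \<longleftrightarrow> g \<in> C0 \<and> (\<forall>x. \<bar>g x\<bar> \<le> 1) \<and> (\<forall>x. x \<notin> V \<longrightarrow> g x = 0)"

definition bump :: "'k set \<Rightarrow> 'k set \<Rightarrow> ('k \<Rightarrow> real) \<Rightarrow> bool" where
  "bump V W f \<longleftrightarrow> unit_on V f \<and> meets W \<and> W \<subseteq> V \<and> (\<forall>x\<in>W. f x = 1)"

text \<open>Quantifying over all \<open>V\<close> allows the next bump to be placed inside the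
  plateau of the previous one; restricting to compact \<open>C\<close> makes goodness pass to unions
  of chains of open sets.\<close>

definition good :: "'l set \<Rightarrow> bool" where
  "good U \<longleftrightarrow> (\<forall>C V \<epsilon>. compact C \<longrightarrow> C \<subseteq> U \<longrightarrow> meets V \<longrightarrow> 0 < \<epsilon> \<longrightarrow>
     (\<exists>f W. bump V W f \<and> (\<forall>z\<in>C. norm (T f z) \<le> \<epsilon>)))"

lemma T_zero: "T (\<lambda>_. 0) y = 0"
  using T_scaleR[OF C0_zero, of 0] by simp

lemma norm_T_le:
  assumes "g \<in> C0" "\<And>x. \<bar>g x\<bar> \<le> s"
  shows "norm (T g y) \<le> \<beta> * s"
proof -
  have "norm (T g y) \<le> supnorm (T g)"
    using C0_bounded[OF T_C0[OF assms(1)]] norm_le_supnorm by metis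
  also have "\<dots> \<le> \<beta> * supnorm g" using \<beta>(2) assms(1) .
  also have "\<dots> \<le> \<beta> * s"
    using \<beta>(1) assms(2) by (intro mult_left_mono supnorm_le) auto
  finally show ?thesis .
qed

lemma T_sum:
  fixes p :: nat
  assumes "\<And>j. g j \<in> C0"
  shows "(\<lambda>x. \<Sum>j<p. c j * g j x) \<in> C0"
    and "T (\<lambda>x. \<Sum>j<p. c j * g j x) y = (\<Sum>j<p. c j *\<^sub>R T (g j) y)"
proof (induction p)
  case 0
  {
    case 1 then show ?case by (simp add: C0_zero)
  next
    case 2 then show ?case by (simp add: T_zero)
  }
next
  case (Suc p)
  have s: "(\<lambda>x. c p * g p x) \<in> C0" using C0_scaleR[OF assms, of "c p" p] by simp
  {
    case 1 then show ?case using C0_add[OF Suc(1) s] by simp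
  next
    case 2 then show ?case using T_add[OF Suc(1) s] T_scaleR[OF assms, of "c p" p] Suc(2) by simp
  }
qed

lemma exists_bump:
  assumes "meets V" obtains W f where "bump V W f"
proof -
  obtain x where x: "open V" "x \<in> V" "x \<in> P" using assms by (auto simp: meets_def)
  show thesis
    using C0_bump[OF loc_compact x(1,2)] that x(3) unfolding bump_def unit_on_def meets_def
    by (metis disjoint_iff)
qed

text \<open>No point of \<open>P\<close> is isolated, so \<open>V\<close> contains two points of
  \<open>P\<close>, which Hausdorff separation pulls apart. Iteration yields infinitely many
  disjoint sets.\<close>

lemma meets_split:
  assumes "meets V"
  shows "\<exists>V1 V2. meets V1 \<and> meets V2 \<and> V1 \<subseteq> V \<and> V2 \<subseteq> V \<and> V1 \<inter> V2 = {}"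
proof -
  obtain x where x: "open V" "x \<in> V \<inter> P" using assms by (auto simp: meets_def)
  then obtain y where y: "y \<in> V \<inter> P" "x \<noteq> y" using P_dense_in_itself[of V x] by blast
  obtain A B where "open A" "open B" "x \<in> A" "y \<in> B" "A \<inter> B = {}" using hausdorff[OF y(2)] by blast
  then show ?thesis using x y
    by (intro exI[of _ "V \<inter> A"] exI[of _ "V \<inter> B"]) (auto simp: meets_def)
qed

text \<open>Since \<open>X\<close> contains no copy of \<open>c\<^sub>0\<close>, disjointly supported functions cannot all have large
  images at a given point.\<close>

lemma small_at_point:
  assumes V: "meets V" and "\<epsilon> > 0"
  shows "\<exists>W. meets W \<and> W \<subseteq> V \<and> (\<forall>g. unit_on W g \<longrightarrow> norm (T g y) \<le> \<epsilon>)"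
proof (rule ccontr)
  assume "\<not> ?thesis"
  then have "\<exists>g. meets W \<longrightarrow> W \<subseteq> V \<longrightarrow> unit_on W g \<and> \<epsilon> \<le> norm (T g y)" for W
    by (metis linear)
  then obtain G where G: "\<And>W. meets W \<Longrightarrow> W \<subseteq> V \<Longrightarrow> unit_on W (G W) \<and> \<epsilon> \<le> norm (T (G W) y)"
    by metis
  from meets_split obtain s1 s2 where s: "\<And>V. meets V \<Longrightarrow> meets (s1 V) \<and> meets (s2 V) \<and>
      s1 V \<subseteq> V \<and> s2 V \<subseteq> V \<and> s1 V \<inter> s2 V = {}"
    by metis
  \<comment> \<open>\<open>R j\<close> is the remainder after \<open>j\<close> splittings: one half
    of it becomes \<open>W j\<close>, the other is kept for all later sets.\<close>
  define R where "R j = (s2 ^^ j) V" for j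
  have RS: "R (Suc j) = s2 (R j)" for j by (simp add: R_def)
  have R: "meets (R j)" for j by (induction j) (use V s in \<open>auto simp: R_def\<close>)
  have Rmono: "R j \<subseteq> R i" if "i \<le> j" for i j
    using that by (rule lift_Suc_antimono_le[rotated]) (simp add: RS s R)
  define W where "W j = s1 (R j)" for j
  have W: "meets (W j)" "W j \<subseteq> V" for j
    using s[OF R[of j]] Rmono[of 0 j] by (auto simp: W_def R_def)
  have disj: "W i \<inter> W j = {}" if "i < j" for i j
    using s[OF R[of i]] s[OF R[of j]] Rmono[of "Suc i" j] that by (auto simp: W_def RS)
  define g where "g j = G (W j)" for j
  have g: "g j \<in> C0" "\<bar>g j x\<bar> \<le> 1" "x \<notin> W j \<Longrightarrow> g j x = 0" "\<epsilon> \<le> norm (T (g j) y)" for j x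
    using G[OF W, of j] by (auto simp: g_def unit_on_def)
  have "\<exists>S :: (nat \<Rightarrow> real) \<Rightarrow> 'x. iso_embedding_on C0 supnorm norm S"
  \<comment> \<open>Disjoint supports keep every combination with coefficients in [-1, 1] in the
    unit ball, so the values at \<open>y\<close> have norm at most \<open>\<beta>\<close>.\<close>
  proof (rule c0_embedding_of_bounded_series[of "\<lambda>j. T (g j) y" \<beta> \<epsilon>])
    fix c :: "nat \<Rightarrow> real" and p assume c: "\<And>j. \<bar>c j\<bar> \<le> 1"
    have "\<bar>\<Sum>j<p. c j * g j x\<bar> \<le> 1" for x
    proof (rule abs_sum_disjoint_le_one)
      show "\<bar>c j * g j x\<bar> \<le> 1" for j
        using c[of j] g(2)[of j x] by (simp add: abs_mult mult_le_one)
      show "c i * g i x = 0 \<or> c j * g j x = 0" if "i \<noteq> j" for i j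
        using disj[of i j] disj[of j i] g(3)[of x i] g(3)[of x j] that by (auto simp: neq_iff)
    qed simp
    then have "norm (T (\<lambda>x. \<Sum>j<p. c j * g j x) y) \<le> \<beta> * 1"
      by (intro norm_T_le T_sum(1) g(1))
    then show "norm (\<Sum>j<p. c j *\<^sub>R T (g j) y) \<le> \<beta>" by (simp add: T_sum(2) g(1))
  qed (use g(4) \<open>\<epsilon> > 0\<close> in auto)
  then show False using no_c0 by blast
qed

text \<open>Nested bumps \<open>f\<^sub>1, f\<^sub>2, \<dots>\<close>, each equal to 1 where the next one lives, are chosen so that
  their images are large on disjoint subsets of \<open>M\<close>. The averages then have norm 1 but images
  tending to 0 on \<open>M\<close>.\<close>

lemma bump_small_by_averaging:
  assumes U: "good U" and V: "meets V" and "\<epsilon> > 0"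
    and cpt: "\<And>g. unit_on V g \<Longrightarrow>
       compact {z\<in>M. \<epsilon> \<le> norm (T g z)} \<and> {z\<in>M. \<epsilon> \<le> norm (T g z)} \<subseteq> U"
  shows "\<exists>f W. bump V W f \<and> (\<forall>z\<in>M. norm (T f z) \<le> 2 * \<epsilon>)"
proof -
  \<comment> \<open>\<open>h\<close> is the unnormalised sum of \<open>n\<close> nested bumps, and
    \<open>C\<close> collects the points of \<open>M\<close> where some image reached
    \<open>\<epsilon>\<close>. At each point of \<open>M\<close> at most one summand exceeds
    \<open>\<epsilon>\<close>, and that one is bounded by \<open>\<beta>\<close>.\<close>
  define stage where "stage n h W C \<longleftrightarrow>
      h \<in> C0 \<and> (\<forall>x. \<bar>h x\<bar> \<le> real n) \<and> (\<forall>x. x \<notin> V \<longrightarrow> h x = 0)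
      \<and> meets W \<and> W \<subseteq> V \<and> (\<forall>x\<in>W. h x = real n) \<and> compact C \<and> C \<subseteq> U
      \<and> (\<forall>z\<in>M. norm (T h z) \<le> \<beta> + real n * \<epsilon>) \<and> (\<forall>z\<in>M - C. norm (T h z) \<le> real n * \<epsilon>)"
    for n h W C
  have step: "\<exists>h W C. stage n h W C" for n
  proof (induction n)
    case 0
    have "stage 0 (\<lambda>_. 0) V {}" using V \<beta> by (simp add: stage_def C0_zero T_zero)
    then show ?case by blast
  next
    case (Suc n)
    then obtain h W C where "stage n h W C" by blast
    then have h: "h \<in> C0" "\<And>x. \<bar>h x\<bar> \<le> real n" "\<And>x. x \<notin> V \<Longrightarrow> h x = 0"
      and W: "meets W" "W \<subseteq> V" "\<And>x. x \<in> W \<Longrightarrow> h x = real n" and C: "compact C" "C \<subseteq> U"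
      and Th: "\<And>z. z \<in> M \<Longrightarrow> norm (T h z) \<le> \<beta> + real n * \<epsilon>"
        "\<And>z. z \<in> M - C \<Longrightarrow> norm (T h z) \<le> real n * \<epsilon>"
      by (auto simp: stage_def)
    \<comment> \<open>Goodness of \<open>U\<close> makes the new image small exactly where earlier
      ones may be large.\<close>
    obtain f W' where f: "bump W W' f" and fC: "\<And>z. z \<in> C \<Longrightarrow> norm (T f z) \<le> \<epsilon>"
      using U C W(1) \<open>\<epsilon> > 0\<close> unfolding good_def by metis
    have f1: "f \<in> C0" "\<And>x. \<bar>f x\<bar> \<le> 1" "\<And>x. x \<notin> W \<Longrightarrow> f x = 0"
      and W': "meets W'" "W' \<subseteq> W" "\<And>x. x \<in> W' \<Longrightarrow> f x = 1"
      using f by (auto simp: bump_def unit_on_def)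
    define D where "D = {z\<in>M. \<epsilon> \<le> norm (T f z)}"
    have "unit_on V f" using f1 W(2) by (auto simp: unit_on_def)
    then have D: "compact D" "D \<subseteq> U" using cpt by (auto simp: D_def)
    have T: "T (\<lambda>x. h x + f x) z = T h z + T f z" for z using T_add h(1) f1(1) by simp
    have "norm (T (\<lambda>x. h x + f x) z) \<le> \<beta> + real (Suc n) * \<epsilon>" if z: "z \<in> M" for z
    proof (cases "z \<in> C")
      case True
      then show ?thesis
        using norm_triangle_ineq[of "T h z" "T f z"] fC Th(1)[OF z] unfolding T
        by (fastforce simp: algebra_simps)
    next
      case False
      then show ?thesis
        using norm_triangle_ineq[of "T h z" "T f z"] norm_T_le[OF f1(1,2), of z] Th(2)[of z] z \<open>\<epsilon> > 0\<close>
        unfolding T by (simp add: algebra_simps)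
    qed
    moreover have "norm (T (\<lambda>x. h x + f x) z) \<le> real (Suc n) * \<epsilon>" if z: "z \<in> M - (C \<union> D)" for z
      using norm_triangle_ineq[of "T h z" "T f z"] Th(2)[of z] z
      unfolding T by (auto simp: algebra_simps D_def)
    moreover have "\<bar>h x + f x\<bar> \<le> real (Suc n)" for x using h(2)[of x] f1(2)[of x] by simp
    moreover have "h x + f x = 0" if "x \<notin> V" for x using h(3) f1(3) W(2) that by auto
    moreover have "h x + f x = real (Suc n)" if "x \<in> W'" for x using W(3) W' that by auto
    moreover have "W' \<subseteq> V" "compact (C \<union> D)" "C \<union> D \<subseteq> U" using W W' C D by auto
    ultimately have "stage (Suc n) (\<lambda>x. h x + f x) W' (C \<union> D)"
      unfolding stage_def using C0_add[OF h(1) f1(1)] W'(1) by (intro conjI allI ballI impI) assumption+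
    then show ?case by blast
  qed
  \<comment> \<open>With this \<open>n\<close>, the averaged bound
    \<open>\<beta> / n + \<epsilon>\<close> is at most \<open>2 * \<epsilon>\<close>.\<close>
  obtain n where n: "\<beta> / \<epsilon> < real n" using reals_Archimedean2 by blast
  then have n0: "0 < real n" using \<beta>(1) \<open>\<epsilon> > 0\<close> by (smt (verit) divide_pos_pos)
  obtain h W C where "stage n h W C" using step by blast
  then have h: "h \<in> C0" "\<And>x. \<bar>h x\<bar> \<le> real n" "\<And>x. x \<notin> V \<Longrightarrow> h x = 0"
      and W: "meets W" "W \<subseteq> V" "\<And>x. x \<in> W \<Longrightarrow> h x = real n"
      and Th: "\<And>z. z \<in> M \<Longrightarrow> norm (T h z) \<le> \<beta> + real n * \<epsilon>"
    by (auto simp: stage_def)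
  define f where "f = (\<lambda>x. (1 / real n) *\<^sub>R h x)"
  have "bump V W f"
    using C0_scaleR[OF h(1), of "1 / real n"] h n0 W by (auto simp: bump_def unit_on_def f_def)
  moreover have "norm (T f z) \<le> 2 * \<epsilon>" if "z \<in> M" for z
  proof -
    have "norm (T f z) = norm (T h z) / real n"
      using T_scaleR[OF h(1), of "1 / real n"] n0 unfolding f_def by simp
    also have "\<dots> \<le> (\<beta> + real n * \<epsilon>) / real n" using Th[OF that] n0 by (simp add: divide_right_mono)
    also have "\<dots> \<le> 2 * \<epsilon>" using n n0 \<open>\<epsilon> > 0\<close> by (simp add: field_simps)
    finally show ?thesis .
  qed
  ultimately show ?thesis by blast
qed

section \<open>Exhaustion of a scattered space by good sets\<close>

lemma compact_norm_T_ge: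
  assumes "g \<in> C0" "0 < \<epsilon>"
  shows "compact {z. \<epsilon> \<le> norm (T g z)}"
  using T_C0[OF assms(1)] assms(2) by (simp add: C0_def)

lemma good_insert:
  assumes "good U"
  shows "good (insert y U)"
  unfolding good_def
proof (intro allI impI)
  fix C V and \<epsilon> :: real
  assume C: "compact C" "C \<subseteq> insert y U" and V: "meets V" and \<epsilon>: "0 < \<epsilon>"
  \<comment> \<open>As \<open>\<epsilon>/4\<close> lies below the averaging threshold
    \<open>\<epsilon>/2\<close>, \<open>y\<close> is outside the level sets, which therefore lie in
    \<open>U\<close>. Averaging doubles the threshold to \<open>\<epsilon>\<close>.\<close>
  obtain V' where V': "meets V'" "V' \<subseteq> V" and small: "\<And>g. unit_on V' g \<Longrightarrow> norm (T g y) \<le> \<epsilon>/4"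
    using small_at_point[OF V, of "\<epsilon>/4" y] \<epsilon> by auto
  have "\<exists>f W. bump V' W f \<and> (\<forall>z\<in>C. norm (T f z) \<le> 2 * (\<epsilon>/2))"
  proof (rule bump_small_by_averaging[OF assms V'(1)])
    fix g assume g: "unit_on V' g"
    then have "continuous_on UNIV (T g)" using T_C0 by (auto simp: unit_on_def C0_def)
    then have "compact (C \<inter> {z. \<epsilon>/2 \<le> norm (T g z)})"
      by (intro compact_Int_closed C closed_norm_ge)
    moreover have "C \<inter> {z. \<epsilon>/2 \<le> norm (T g z)} = {z\<in>C. \<epsilon>/2 \<le> norm (T g z)}" by blast
    moreover have "y \<notin> {z\<in>C. \<epsilon>/2 \<le> norm (T g z)}" using small[OF g] \<epsilon> by auto
    ultimately show "compact {z\<in>C. \<epsilon>/2 \<le> norm (T g z)} \<and> {z\<in>C. \<epsilon>/2 \<le> norm (T g z)} \<subseteq> U"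
      using C(2) by auto
  qed (use \<epsilon> in simp)
  then obtain f W where f: "bump V' W f" "\<forall>z\<in>C. norm (T f z) \<le> \<epsilon>" by auto
  then have "bump V W f" using V'(2) unfolding bump_def unit_on_def by blast
  then show "\<exists>f W. bump V W f \<and> (\<forall>z\<in>C. norm (T f z) \<le> \<epsilon>)" using f(2) by blast
qed

lemma good_UNIV:
  assumes "scattered_space TYPE('l)"
  shows "good UNIV"
proof -
  have "\<exists>U\<in>{U. open U \<and> good U}. \<forall>U'\<in>{U. open U \<and> good U}. U \<subseteq> U' \<longrightarrow> U' = U"
  proof (rule subset_Zorn_nonempty)
    have "good {}" using exists_bump unfolding good_def by (metis empty_iff subset_empty)
    then show "{U. open U \<and> good U} \<noteq> {}" by blast
  next
    fix \<C> assume ne: "\<C> \<noteq> {}" and ch: "subset.chain {U. open U \<and> good U} \<C>"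
    then have \<C>: "\<And>U. U \<in> \<C> \<Longrightarrow> open U \<and> good U" by (auto simp: subset.chain_def)
    have "good (\<Union>\<C>)"
      unfolding good_def
    proof (intro allI impI)
      fix C V and \<epsilon> :: real
      assume C: "compact C" "C \<subseteq> \<Union>\<C>" and V: "meets V" and \<epsilon>: "0 < \<epsilon>"
      obtain \<D> where \<D>: "\<D> \<subseteq> \<C>" "finite \<D>" "C \<subseteq> \<Union>\<D>" using compactE[OF C] \<C> by blast
      have "subset.chain {U. open U \<and> good U} \<D>" using ch \<D>(1) unfolding subset.chain_def by blast
      then have "\<D> \<noteq> {} \<Longrightarrow> \<Union>\<D> \<in> \<D>" using Union_in_chain \<D>(2) by blast
      \<comment> \<open>A nonempty finite subchain contains its union; if it is empty, any member of
        the chain serves.\<close>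
      then have "\<exists>U\<in>\<C>. \<Union>\<D> \<subseteq> U" using \<D>(1) ne by (cases "\<D> = {}") auto
      then show "\<exists>f W. bump V W f \<and> (\<forall>z\<in>C. norm (T f z) \<le> \<epsilon>)"
        using \<C> C(1) \<D>(3) V \<epsilon> unfolding good_def by (metis subset_trans)
    qed
    then show "\<Union>\<C> \<in> {U. open U \<and> good U}" using \<C> by blast
  qed
  then obtain U where U: "open U" "good U" and max: "\<And>U'. open U' \<Longrightarrow> good U' \<Longrightarrow> U \<subseteq> U' \<Longrightarrow> U' = U"
    by blast
  have "U = UNIV"
  proof (rule ccontr)
    assume "U \<noteq> UNIV"
    then obtain y O' where y: "y \<in> - U" "open O'" "O' \<inter> - U = {y}"
      using assms[unfolded scattered_space_def, rule_format, of "- U"] by auto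
    \<comment> \<open>An isolated point of the complement can be added to \<open>U\<close> without
      losing openness.\<close>
    then have "insert y U = U \<union> O'" by blast
    then have "open (insert y U)" using U(1) y(2) by (simp add: open_Un)
    then show False using max[OF _ good_insert[OF U(2)]] y(1) by blast
  qed
  then show ?thesis using U(2) by simp
qed

lemma not_scattered:
  assumes "P \<noteq> {}"
  shows "\<not> scattered_space TYPE('l)"
proof
  assume "scattered_space TYPE('l)"
  then have U: "good UNIV" by (rule good_UNIV)
  have V: "meets UNIV" using assms by (simp add: meets_def)
  \<comment> \<open>With \<open>M\<close> the whole space, the level sets are compact because images
    vanish at infinity. The threshold \<open>\<alpha>/4\<close> doubles to
    \<open>\<alpha>/2\<close>, below the lower bound \<open>\<alpha>\<close>.\<close>
  have "\<exists>f W. bump UNIV W f \<and> (\<forall>z\<in>UNIV. norm (T f z) \<le> 2 * (\<alpha>/4))"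
    using compact_norm_T_ge \<alpha>(1)
    by (intro bump_small_by_averaging[OF U V]) (auto simp: unit_on_def simp del: le_divide_eq_numeral1 divide_le_eq_numeral1)
  then obtain f W where f: "f \<in> C0" "\<And>x. norm (f x) \<le> 1" and W: "meets W" "\<And>x. x \<in> W \<Longrightarrow> f x = 1"
    and Tf: "\<And>z. norm (T f z) \<le> \<alpha>/2"
    by (auto simp: bump_def unit_on_def)
  obtain x where "x \<in> W" using W(1) by (auto simp: meets_def)
  moreover have "norm (f x) \<le> supnorm f" by (rule norm_le_supnorm) (rule f(2))
  ultimately have "1 \<le> supnorm f" using W(2) by simp
  then have "\<alpha> \<le> \<alpha> * supnorm f" using \<alpha>(1) by (simp add: mult_le_cancel_left1)
  also have "\<dots> \<le> supnorm (T f)" using \<alpha>(2) f(1) .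
  also have "\<dots> \<le> \<alpha>/2" using Tf by (rule supnorm_le)
  finally show False using \<alpha>(1) by simp
qed

end

theorem theorem1p2:
  fixes T :: "('k::t2_space \<Rightarrow> real) \<Rightarrow> ('l::t2_space \<Rightarrow> 'x::banach)"
  assumes "locally_compact_space (euclidean :: 'k topology)"
    and "locally_compact_space (euclidean :: 'l topology)"
    and no_c0: "\<not> (\<exists>S :: (nat \<Rightarrow> real) \<Rightarrow> 'x. iso_embedding_on C0 supnorm norm S)"
    and "T ` C0 \<subseteq> C0"
    and "iso_embedding_fun_on C0 supnorm supnorm T"
    and "scattered_space TYPE('l)"
  shows "scattered_space TYPE('k)"
proof (rule ccontr)
  assume "\<not> scattered_space TYPE('k)"
  then obtain P :: "'k set" where P: "P \<noteq> {}" "\<And>x U. open U \<Longrightarrow> U \<inter> P \<noteq> {x}"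
    unfolding scattered_space_def by (metis IntD2 insertI1)
  have T_add: "T (\<lambda>x. f x + g x) = (\<lambda>y. T f y + T g y)" if "f \<in> C0" "g \<in> C0" for f g
    using assms(5) that unfolding iso_embedding_fun_on_def by blast
  have T_scaleR: "T (\<lambda>x. c *\<^sub>R f x) = (\<lambda>y. c *\<^sub>R T f y)" if "f \<in> C0" for c f
    using assms(5) that unfolding iso_embedding_fun_on_def by blast
  obtain \<alpha> \<beta> where \<alpha>\<beta>: "\<alpha> > 0" "\<beta> > 0"
    "\<forall>u\<in>C0. \<alpha> * supnorm u \<le> supnorm (T u) \<and> supnorm (T u) \<le> \<beta> * supnorm u"
    using assms(5) unfolding iso_embedding_fun_on_def by blast
  interpret perfect_set_embedding T P \<alpha> \<beta>
  proof
    show "T f \<in> C0" if "f \<in> C0" for f using assms(4) that by blast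
  qed (use assms(1,3) T_add T_scaleR \<alpha>\<beta> P(2) in \<open>blast+\<close>)
  show False using not_scattered[OF P(1)] assms(6) by blast
qed
end
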